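(* $3 \leq \mathrm{Toep}_4 \leq 9$.
   Context: A matrix $T \in \mathbb{C}^{n\times n}$ is called Toeplitz if $T_{i,j} = T_{i+1,j+1}$ for all $i,j \in \{1,\dots,n-1\}$. For $M \in \mathbb{C}^{n\times n}$, the Toeplitz number $\mathrm{Toep}(M)$ is the minimal integer $s \geq 1$ such that $M = T_1 T_2 \cdots T_s$ for some Toeplitz matrices $T_1, \dots, T_s \in \mathbb{C}^{n\times n}$ (to be read as $\infty$ if no such $s$ exists). The maximal Toeplitz number of order $n$, denoted $\mathrm{Toep}_n$, is the maximum of $\mathrm{Toep}(M)$ over all $M \in \mathbb{C}^{n\times n}$. *)

theory Defs
  imports Complex_Main "HOL-Library.Extended_Nat" "Jordan_Normal_Form.Matrix"
begin

text \<open>Matrix entries are indexed from 0, so the indices \<open>1, ..., n - 1\<close> of the usual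
  definition become the \<open>i\<close>, \<open>j\<close> with \<open>i + 1 < n\<close>, \<open>j + 1 < n\<close>.\<close>

definition toeplitz_mat :: "nat \<Rightarrow> complex mat \<Rightarrow> bool" where
  "toeplitz_mat n T \<longleftrightarrow> T \<in> carrier_mat n n \<and>
     (\<forall>i j. i + 1 < n \<and> j + 1 < n \<longrightarrow> T $$ (i, j) = T $$ (i + 1, j + 1))"

text \<open>The product in the given order. The dimension is a parameter because the product of the
  empty list is the identity matrix of order \<open>n\<close>.\<close>

definition prod_mats :: "nat \<Rightarrow> complex mat list \<Rightarrow> complex mat" where
  "prod_mats n Ts = foldr (*) Ts (1\<^sub>m n)"

text \<open>In \<^typ>\<open>enat\<close> the infimum of a nonempty set is its least element, and the infimum of the
  empty set is \<open>\<infinity>\<close>, as required for matrices without a Toeplitz factorization.\<close>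

definition toep :: "nat \<Rightarrow> complex mat \<Rightarrow> enat" where
  "toep n M = Inf {enat s | s. s \<ge> 1 \<and>
     (\<exists>Ts. length Ts = s \<and> (\<forall>T \<in> set Ts. toeplitz_mat n T) \<and> M = prod_mats n Ts)}"

text \<open>The supremum in \<^typ>\<open>enat\<close> is a maximum whenever it is finite; see
  \<open>toep_max_attained\<close> below.\<close>

definition toep_max :: "nat \<Rightarrow> enat" where
  "toep_max n = Sup {toep n M | M. M \<in> carrier_mat n n}"

lemma toep_max_attained:
  assumes "toep_max n \<noteq> \<infinity>"
  shows "\<exists>M \<in> carrier_mat n n. toep n M = toep_max n"
proof -
  let ?A = "{toep n M | M. M \<in> carrier_mat n n}"
  have "toep n (1\<^sub>m n) \<in> ?A" by auto
  then have ne: "?A \<noteq> {}" by blast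
  then have fin: "finite ?A"
    using assms unfolding toep_max_def Sup_enat_def by (auto split: if_splits)
  have "toep_max n = Max ?A"
    using ne fin unfolding toep_max_def Sup_enat_def by auto
  then have "toep_max n \<in> ?A" using Max_in[OF fin ne] by metis
  then show ?thesis by force
qed

end

theory Submission
  imports Defs "HOL-Computational_Algebra.Polynomial_FPS"
begin

text \<open>\<^bold>\<open>Lower bound.\<close> Shifting a product \<open>S * T\<close> of two Toeplitz matrices diagonally by one
  step and subtracting leaves a sum of two matrices of rank at most one, because all inner
  summands of the product cancel (\<open>displacement_toeplitz_mult\<close>). For order 4 this difference
  is a \<open>3 \<times> 3\<close> matrix, so its determinant vanishes. For the diagonal matrix with entries
  \<open>0, 1, 2, 3\<close> the difference is the identity matrix; hence that matrix is not a product of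
  two Toeplitz matrices.

  \<^bold>\<open>Upper bound.\<close> The building blocks are companion matrices, whose columns are
  \<open>e\<^sub>1, ..., e\<^sub>n\<^sub>-\<^sub>1, c\<close> (counting from 0). Each of them is a product \<open>S * T\<close> of two Toeplitz
  matrices: \<open>S\<close> is upper triangular and comes from the characteristic polynomial, \<open>T\<close> is
  Hessenberg and comes from the inverse power series (\<open>companion_toeplitz_product\<close>).

  Let \<open>Q\<^sub>k\<close> have the columns \<open>e\<^sub>k, ..., e\<^sub>n\<^sub>-\<^sub>1, A e\<^sub>0, ..., A e\<^sub>k\<^sub>-\<^sub>1\<close>. Multiplying it on the right by
  a companion matrix drops its first column and appends \<open>Q\<^sub>k c\<close>. So one passes from the
  identity matrix \<open>Q\<^sub>0\<close> to \<open>A = Q\<^sub>n\<close> in \<open>n\<close> steps, which makes \<open>A\<close> a product of \<open>2 n\<close> Toeplitz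
  matrices, as soon as \<open>A e\<^sub>k\<close> is in the range of \<open>Q\<^sub>k\<close> for every \<open>k\<close>. The columns
  \<open>e\<^sub>k, ..., e\<^sub>n\<^sub>-\<^sub>1\<close> take care of the rows from \<open>k\<close> on, so this only asks that the first \<open>k\<close>
  entries of column \<open>k\<close> of \<open>A\<close> lie in the range of the leading \<open>k \<times> k\<close> block
  (\<open>toeplitz_product_of_leading_blocks\<close>); \<open>A\<close> may be singular.

  An arbitrary \<open>4 \<times> 4\<close> matrix \<open>M\<close> is brought into this form by a ninth factor. Let \<open>V\<close> be a
  lower triangular Toeplitz matrix with a generic choice of parameters. If \<open>\<rho>\<close> of the first
  three rows of \<open>M\<close> are linearly independent, then the leading \<open>\<rho> \<times> \<rho>\<close> minor of these rows of
  \<open>M * V\<close> does not vanish. So if the first \<open>k\<close> rows of \<open>M\<close> have rank \<open>\<rho> \<le> k\<close>, where \<open>k \<le> 3\<close>,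
  then already the first \<open>\<rho>\<close> columns of the first \<open>k\<close> rows of \<open>M * V\<close> span the whole column
  space, and the condition holds for \<open>A = M * V\<close> (\<open>generic_leading_blocks_solvable\<close>). Finally
  \<open>M = A * V\<^sup>-\<^sup>1\<close>, where \<open>V\<^sup>-\<^sup>1\<close> is again Toeplitz.\<close>

section \<open>Products of a given number of Toeplitz matrices\<close>

definition toeplitz_product :: "nat \<Rightarrow> nat \<Rightarrow> complex mat \<Rightarrow> bool" where
  "toeplitz_product n s M \<longleftrightarrow>
     (\<exists>Ts. length Ts = s \<and> (\<forall>T \<in> set Ts. toeplitz_mat n T) \<and> M = prod_mats n Ts)"

lemma toep_eq: "toep n M = Inf {enat s | s. s \<ge> 1 \<and> toeplitz_product n s M}"
  unfolding toep_def toeplitz_product_def by simp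

lemma prod_mats_carrier:
  "\<forall>T \<in> set Ts. toeplitz_mat n T \<Longrightarrow> prod_mats n Ts \<in> carrier_mat n n"
  by (induction Ts) (auto simp: prod_mats_def toeplitz_mat_def)

lemma prod_mats_append:
  assumes "\<forall>T \<in> set Ss. toeplitz_mat n T" "\<forall>T \<in> set Ts. toeplitz_mat n T"
  shows "prod_mats n (Ss @ Ts) = prod_mats n Ss * prod_mats n Ts"
  using assms(1)
proof (induction Ss)
  case Nil
  then show ?case using prod_mats_carrier[OF assms(2)] by (simp add: prod_mats_def)
next
  case (Cons S Ss)
  have "S \<in> carrier_mat n n" using Cons.prems by (simp add: toeplitz_mat_def)
  moreover have "prod_mats n Ss \<in> carrier_mat n n" using Cons.prems prod_mats_carrier by simp
  ultimately have "S * prod_mats n Ss * prod_mats n Ts = S * (prod_mats n Ss * prod_mats n Ts)"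
    using prod_mats_carrier[OF assms(2)] by (rule assoc_mult_mat)
  then show ?case using Cons by (simp add: prod_mats_def)
qed

lemma toeplitz_product_mult:
  assumes "toeplitz_product n s A" "toeplitz_product n r B"
  shows "toeplitz_product n (s + r) (A * B)"
proof -
  obtain Ss Ts where "length Ss = s" "\<forall>T \<in> set Ss. toeplitz_mat n T" "A = prod_mats n Ss"
    "length Ts = r" "\<forall>T \<in> set Ts. toeplitz_mat n T" "B = prod_mats n Ts"
    using assms unfolding toeplitz_product_def by blast
  then show ?thesis
    unfolding toeplitz_product_def
    by (intro exI[of _ "Ss @ Ts"]) (auto simp: prod_mats_append)
qed

lemma toeplitz_product_one: "toeplitz_mat n T \<Longrightarrow> toeplitz_product n 1 T"
  unfolding toeplitz_product_def
  by (intro exI[of _ "[T]"]) (auto simp: prod_mats_def toeplitz_mat_def)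

lemma toeplitz_product_two_iff:
  "toeplitz_product n 2 M \<longleftrightarrow> (\<exists>S T. toeplitz_mat n S \<and> toeplitz_mat n T \<and> M = S * T)"
proof
  assume "toeplitz_product n 2 M"
  then obtain Ts where Ts: "length Ts = 2" "\<forall>T \<in> set Ts. toeplitz_mat n T" "M = prod_mats n Ts"
    unfolding toeplitz_product_def by blast
  then obtain S T where "Ts = [S, T]"
    by (auto simp: length_Suc_conv numeral_2_eq_2)
  then have "toeplitz_mat n S" "toeplitz_mat n T" "M = S * T"
    using Ts by (auto simp: prod_mats_def toeplitz_mat_def)
  then show "\<exists>S T. toeplitz_mat n S \<and> toeplitz_mat n T \<and> M = S * T"
    by blast
next
  assume "\<exists>S T. toeplitz_mat n S \<and> toeplitz_mat n T \<and> M = S * T"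
  then show "toeplitz_product n 2 M"
    using toeplitz_product_mult[OF toeplitz_product_one toeplitz_product_one]
    by (auto simp: numeral_2_eq_2)
qed

section \<open>The displacement of a product of two Toeplitz matrices\<close>

lemma mult_mat_index_sum:
  assumes "A \<in> carrier_mat n n" "B \<in> carrier_mat n n" "i < n" "j < n"
  shows "(A * B) $$ (i, j) = (\<Sum>l<n. A $$ (i, l) * B $$ (l, j))"
  using assms by (simp add: scalar_prod_def atLeast0LessThan)

text \<open>In the two sums over \<open>l\<close>, the summand \<open>l + 1\<close> of the first equals the summand \<open>l\<close> of the
  second by the Toeplitz property of both factors. Only the first summand of the former and
  the last summand of the latter survive.\<close>

lemma displacement_toeplitz_mult:
  assumes S: "toeplitz_mat (Suc n) S" and T: "toeplitz_mat (Suc n) T" and "i < n" "j < n"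
  shows "(S * T) $$ (Suc i, Suc j) - (S * T) $$ (i, j) =
    S $$ (Suc i, 0) * T $$ (0, Suc j) - S $$ (i, n) * T $$ (n, j)"
proof -
  have c: "S \<in> carrier_mat (Suc n) (Suc n)" "T \<in> carrier_mat (Suc n) (Suc n)"
    using S T by (auto simp: toeplitz_mat_def)
  have "S $$ (Suc i, Suc l) = S $$ (i, l)" "T $$ (Suc l, Suc j) = T $$ (l, j)" if "l < n" for l
    using S T that assms(3,4) by (auto simp: toeplitz_mat_def)
  then have "(S * T) $$ (Suc i, Suc j) =
      S $$ (Suc i, 0) * T $$ (0, Suc j) + (\<Sum>l<n. S $$ (i, l) * T $$ (l, j))"
    using mult_mat_index_sum[OF c, of "Suc i" "Suc j"] assms(3,4)
    by (simp add: sum.lessThan_Suc_shift del: sum.lessThan_Suc)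
  moreover have "(S * T) $$ (i, j) = (\<Sum>l<n. S $$ (i, l) * T $$ (l, j)) + S $$ (i, n) * T $$ (n, j)"
    using mult_mat_index_sum[OF c, of i j] assms(3,4) by simp
  ultimately show ?thesis by simp
qed

text \<open>The determinant of a sum of two \<open>3 \<times> 3\<close> matrices of rank at most one is zero.\<close>

lemma det3_rank_two_ne_identity:
  fixes x y z w :: "nat \<Rightarrow> complex"
  assumes "\<And>i j. i < 3 \<Longrightarrow> j < 3 \<Longrightarrow> x i * y j - z i * w j = (if i = j then 1 else 0)"
  shows False
proof -
  define d where "d i j = x i * y j - z i * w j" for i j
  have "d 0 0 * (d 1 1 * d 2 2 - d 1 2 * d 2 1) - d 0 1 * (d 1 0 * d 2 2 - d 1 2 * d 2 0)
      + d 0 2 * (d 1 0 * d 2 1 - d 1 1 * d 2 0) = 0"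
    unfolding d_def by (simp add: algebra_simps)
  moreover have "d i j = (if i = j then 1 else 0)" if "i < 3" "j < 3" for i j
    using assms[OF that] by (simp add: d_def)
  ultimately show False by simp
qed

text \<open>Any matrix whose displacement has full rank would serve for the lower bound; the
  displacement of this one is the identity matrix.\<close>

definition ramp_mat :: "complex mat" where
  "ramp_mat = mat 4 4 (\<lambda>(i, j). if i = j then of_nat i else 0)"

lemma ramp_mat_not_two_toeplitz: "\<not> toeplitz_product 4 2 ramp_mat"
proof
  assume "toeplitz_product 4 2 ramp_mat"
  then obtain S T where ST: "toeplitz_mat (Suc 3) S" "toeplitz_mat (Suc 3) T" "ramp_mat = S * T"
    unfolding toeplitz_product_two_iff by auto
  have "S $$ (Suc i, 0) * T $$ (0, Suc j) - S $$ (i, 3) * T $$ (3, j) = (if i = j then 1 else 0)"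
    if "i < 3" "j < 3" for i j
    using displacement_toeplitz_mult[OF ST(1,2) that] that
    unfolding ST(3)[symmetric] by (auto simp: ramp_mat_def)
  then show False by (rule det3_rank_two_ne_identity)
qed

lemma toep_ramp_mat: "toep 4 ramp_mat \<ge> 3"
proof -
  have "\<not> toeplitz_product 4 1 ramp_mat"
  proof
    assume "toeplitz_product 4 1 ramp_mat"
    moreover have "toeplitz_product 4 1 (1\<^sub>m 4)"
      by (rule toeplitz_product_one) (auto simp: toeplitz_mat_def)
    ultimately have "toeplitz_product 4 (1 + 1) (ramp_mat * 1\<^sub>m 4)"
      by (rule toeplitz_product_mult)
    moreover have "ramp_mat * 1\<^sub>m 4 = ramp_mat"
      by (rule right_mult_one_mat[of _ 4]) (simp add: ramp_mat_def)
    ultimately show False using ramp_mat_not_two_toeplitz by (simp add: numeral_2_eq_2)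
  qed
  then have "s \<ge> 3" if "s \<ge> 1" "toeplitz_product 4 s ramp_mat" for s
    using that ramp_mat_not_two_toeplitz
    by (metis One_nat_def Suc_1 le_antisym not_less_eq_eq numeral_3_eq_3)
  then show ?thesis
    unfolding toep_eq by (auto intro!: Inf_greatest simp: numeral_eq_enat)
qed

section \<open>Companion matrices\<close>

definition companion :: "nat \<Rightarrow> (nat \<Rightarrow> complex) \<Rightarrow> complex mat" where
  "companion n c = mat n n (\<lambda>(i, j). if j + 1 < n then (if i = j + 1 then 1 else 0) else c i)"

text \<open>The upper triangular Toeplitz matrix \<open>S\<close> of the power series
  \<open>F = 1 - c\<^sub>n\<^sub>-\<^sub>1 X - ... - c\<^sub>0 X\<^sup>n\<close> is multiplied by the Hessenberg Toeplitz matrix \<open>T\<close> of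
  \<open>G = 1 / F\<close>, whose leading coefficient is on the subdiagonal. The entries of the product are
  convolutions of the coefficients of \<open>F\<close> and \<open>G\<close>, hence coefficients of \<open>F * G = 1\<close>. In the
  last column the convolution is cut off by the border of the matrix just before its last
  summand \<open>- c\<^sub>i\<close>, and this missing summand produces the column \<open>c\<close>.\<close>

lemma companion_toeplitz_product: "toeplitz_product n 2 (companion n c)"
proof -
  define F where "F = Abs_fps (\<lambda>k. if k = 0 then 1 else if k \<le> n then - c (n - k) else 0)"
  define G where "G = inverse F"
  have FG: "F * G = 1"
    unfolding G_def by (rule inverse_mult_eq_1') (simp add: F_def)
  have G0: "fps_nth G 0 = 1" by (simp add: G_def F_def)
  define S where "S = mat n n (\<lambda>(i, j). if i \<le> j then fps_nth F (j - i) else 0)"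
  define T where "T = mat n n (\<lambda>(i, j). if i \<le> j + 1 then fps_nth G (j + 1 - i) else 0)"
  have "toeplitz_mat n S" "toeplitz_mat n T"
    by (auto simp: toeplitz_mat_def S_def T_def)
  moreover have "companion n c = S * T"
  proof (rule eq_matI)
    fix i j assume ij: "i < dim_row (S * T)" "j < dim_col (S * T)"
    then have ij: "i < n" "j < n" by (auto simp: S_def T_def)
    let ?h = "\<lambda>l. fps_nth F (l - i) * fps_nth G (j + 1 - l)"
    have conv: "(\<Sum>l\<in>{i..j+1}. ?h l) = (if i = j + 1 then 1 else 0)"
    proof (cases "i \<le> j + 1")
      case True
      have "(\<Sum>l\<in>{i..j+1}. ?h l) = (\<Sum>m\<in>{0..j+1-i}. fps_nth F m * fps_nth G (j + 1 - i - m))"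
        using True by (intro sum.reindex_bij_witness[of _ "\<lambda>m. m + i" "\<lambda>l. l - i"]) auto
      also have "\<dots> = fps_nth (F * G) (j + 1 - i)" by (simp add: fps_mult_nth)
      finally show ?thesis using True FG by auto
    qed auto
    have "(S * T) $$ (i, j) = (\<Sum>l<n. S $$ (i, l) * T $$ (l, j))"
      by (rule mult_mat_index_sum) (use ij in \<open>auto simp: S_def T_def\<close>)
    also have "\<dots> = (\<Sum>l\<in>{i..j+1} \<inter> {..<n}. ?h l)"
      by (rule sum.mono_neutral_cong_right) (use ij in \<open>auto simp: S_def T_def\<close>)
    also have "\<dots> = companion n c $$ (i, j)"
    proof (cases "j + 1 < n")
      case True
      then have "{i..j+1} \<inter> {..<n} = {i..j+1}" by auto
      then show ?thesis using conv True ij by (simp add: companion_def)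
    next
      case False
      then have n: "n = j + 1" using ij by simp
      then have "{i..j+1} = insert n ({i..j+1} \<inter> {..<n})" using ij by auto
      then have "(\<Sum>l\<in>{i..j+1}. ?h l) = ?h n + (\<Sum>l\<in>{i..j+1} \<inter> {..<n}. ?h l)"
        by (metis (no_types, lifting) IntE finite_Int finite_lessThan lessThan_iff less_irrefl
            sum.insert)
      moreover have "?h n = - c i" using n ij G0 by (simp add: F_def)
      ultimately show ?thesis using conv n ij by (simp add: companion_def)
    qed
    finally show "companion n c $$ (i, j) = (S * T) $$ (i, j)" by simp
  qed (auto simp: S_def T_def companion_def)
  ultimately show ?thesis unfolding toeplitz_product_two_iff by blast
qed

text \<open>Place the columns of the identity matrix and then those of \<open>A\<close> side by side; this is the
  window of \<open>n\<close> consecutive columns that starts at column \<open>k\<close>. It is the identity matrix for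
  \<open>k = 0\<close> and \<open>A\<close> for \<open>k = n\<close>.\<close>

definition column_window :: "nat \<Rightarrow> complex mat \<Rightarrow> nat \<Rightarrow> complex mat" where
  "column_window n A k = mat n n (\<lambda>(i, j).
     if j + k < n then (if i = j + k then 1 else 0) else A $$ (i, j + k - n))"

text \<open>The companion matrix moves every column of its left factor one place to the left and
  fills the last place with the image of \<open>c\<close>.\<close>

lemma column_window_step:
  assumes A: "A \<in> carrier_mat n n" and k: "k < n"
    and c: "\<And>i. i < n \<Longrightarrow> (\<Sum>l<n. column_window n A k $$ (i, l) * c l) = A $$ (i, k)"
  shows "column_window n A k * companion n c = column_window n A (Suc k)"
proof (rule eq_matI)
  fix i j assume "i < dim_row (column_window n A (Suc k))" "j < dim_col (column_window n A (Suc k))"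
  then have ij: "i < n" "j < n" by (auto simp: column_window_def)
  have eq: "(column_window n A k * companion n c) $$ (i, j) =
      (\<Sum>l<n. column_window n A k $$ (i, l) * companion n c $$ (l, j))"
    by (rule mult_mat_index_sum) (use ij in \<open>auto simp: column_window_def companion_def\<close>)
  show "(column_window n A k * companion n c) $$ (i, j) = column_window n A (Suc k) $$ (i, j)"
  proof (cases "j + 1 < n")
    case True
    have "(\<Sum>l<n. column_window n A k $$ (i, l) * companion n c $$ (l, j)) =
        (\<Sum>l<n. if l = j + 1 then column_window n A k $$ (i, l) else 0)"
      using True ij by (intro sum.cong) (auto simp: companion_def)
    also have "\<dots> = column_window n A k $$ (i, j + 1)" using True by simp
    finally show ?thesis using eq True ij by (simp add: column_window_def)
  next
    case False
    then have "j = n - 1" using ij by simp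
    moreover have "(\<Sum>l<n. column_window n A k $$ (i, l) * companion n c $$ (l, j)) =
        (\<Sum>l<n. column_window n A k $$ (i, l) * c l)"
      using False ij by (intro sum.cong) (auto simp: companion_def)
    ultimately show ?thesis using eq c[OF ij(1)] ij k by (simp add: column_window_def)
  qed
qed (auto simp: column_window_def companion_def)

text \<open>To move the window by one column, \<open>A e\<^sub>k\<close> has to be written as a combination of the
  columns in the window. The weights \<open>w\<close> of the columns of \<open>A\<close> are given by the leading block;
  the unit vectors in the window then correct the rows from \<open>k\<close> on.\<close>

lemma toeplitz_product_of_leading_blocks:
  assumes A: "A \<in> carrier_mat n n"
    and solv: "\<And>k. k < n \<Longrightarrow> \<exists>w. \<forall>i<k. (\<Sum>j<k. A $$ (i, j) * w j) = A $$ (i, k)"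
  shows "toeplitz_product n (2 * n) A"
proof -
  have "toeplitz_product n (2 * k) (column_window n A k)" if "k \<le> n" for k
    using that
  proof (induction k)
    case 0
    have "column_window n A 0 = prod_mats n []"
      by (auto simp: column_window_def prod_mats_def)
    then show ?case unfolding toeplitz_product_def by auto
  next
    case (Suc k)
    then have k: "k < n" by simp
    obtain w where w: "\<And>i. i < k \<Longrightarrow> (\<Sum>j<k. A $$ (i, j) * w j) = A $$ (i, k)"
      using solv[OF k] by blast
    \<comment> \<open>The window holds \<open>e\<^sub>k, ..., e\<^sub>n\<^sub>-\<^sub>1\<close> in its first \<open>n - k\<close> places.\<close>
    define c where "c l = (if l + k < n then A $$ (l + k, k) - (\<Sum>j<k. A $$ (l + k, j) * w j)
      else w (l + k - n))" for l
    have "(\<Sum>l<n. column_window n A k $$ (i, l) * c l) = A $$ (i, k)" if i: "i < n" for i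
    proof -
      let ?g = "\<lambda>l. column_window n A k $$ (i, l) * c l"
      have "(\<Sum>l<n. ?g l) = (\<Sum>l\<in>{..<n-k} \<union> {n-k..<n}. ?g l)"
        by (rule sum.cong) auto
      also have "\<dots> = (\<Sum>l<n-k. ?g l) + (\<Sum>l\<in>{n-k..<n}. ?g l)"
        by (rule sum.union_disjoint) auto
      also have "(\<Sum>l\<in>{n-k..<n}. ?g l) = (\<Sum>j<k. A $$ (i, j) * w j)"
        by (rule sum.reindex_bij_witness[of _ "\<lambda>j. j + (n - k)" "\<lambda>l. l + k - n"])
          (use k i in \<open>auto simp: column_window_def c_def\<close>)
      also have "(\<Sum>l<n-k. ?g l) = (\<Sum>l<n-k. if l = i - k then (if k \<le> i then c l else 0) else 0)"
        using k i by (intro sum.cong) (auto simp: column_window_def)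
      also have "\<dots> = (if k \<le> i then c (i - k) else 0)" using i k by auto
      finally show ?thesis using i k w[of i] by (auto simp: c_def)
    qed
    from column_window_step[OF A k this]
    have "column_window n A k * companion n c = column_window n A (Suc k)" .
    moreover have "toeplitz_product n (2 * k + 2) (column_window n A k * companion n c)"
      using Suc companion_toeplitz_product by (intro toeplitz_product_mult) auto
    ultimately show ?case by simp
  qed
  moreover have "column_window n A n = A"
    using A by (auto simp: column_window_def)
  ultimately show ?thesis by force
qed

section \<open>Lower triangular Toeplitz matrices\<close>

definition lower_toeplitz :: "nat \<Rightarrow> complex fps \<Rightarrow> complex mat" where
  "lower_toeplitz n f = mat n n (\<lambda>(i, j). if j \<le> i then fps_nth f (i - j) else 0)"

lemma lower_toeplitz_carrier [simp]: "lower_toeplitz n f \<in> carrier_mat n n"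
  by (simp add: lower_toeplitz_def)

lemma toeplitz_lower_toeplitz: "toeplitz_mat n (lower_toeplitz n f)"
  by (auto simp: toeplitz_mat_def lower_toeplitz_def)

lemma lower_toeplitz_mult: "lower_toeplitz n f * lower_toeplitz n g = lower_toeplitz n (f * g)"
proof (rule eq_matI)
  fix i j assume "i < dim_row (lower_toeplitz n (f * g))" "j < dim_col (lower_toeplitz n (f * g))"
  then have ij: "i < n" "j < n" by (auto simp: lower_toeplitz_def)
  have "(lower_toeplitz n f * lower_toeplitz n g) $$ (i, j) =
      (\<Sum>l<n. lower_toeplitz n f $$ (i, l) * lower_toeplitz n g $$ (l, j))"
    by (rule mult_mat_index_sum) (use ij in auto)
  also have "\<dots> = (\<Sum>l\<in>{j..i}. fps_nth f (i - l) * fps_nth g (l - j))"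
    by (rule sum.mono_neutral_cong_right) (use ij in \<open>auto simp: lower_toeplitz_def\<close>)
  also have "\<dots> = lower_toeplitz n (f * g) $$ (i, j)"
  proof (cases "j \<le> i")
    case True
    have "(\<Sum>l\<in>{j..i}. fps_nth f (i - l) * fps_nth g (l - j)) =
        (\<Sum>m\<in>{0..i-j}. fps_nth f m * fps_nth g (i - j - m))"
      using True by (intro sum.reindex_bij_witness[of _ "\<lambda>m. i - m" "\<lambda>l. i - l"]) auto
    then show ?thesis using True ij by (simp add: lower_toeplitz_def fps_mult_nth)
  qed (use ij in \<open>auto simp: lower_toeplitz_def\<close>)
  finally show "(lower_toeplitz n f * lower_toeplitz n g) $$ (i, j) =
      lower_toeplitz n (f * g) $$ (i, j)" .
qed (auto simp: lower_toeplitz_def)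

lemma lower_toeplitz_one: "lower_toeplitz n 1 = 1\<^sub>m n"
  by (rule eq_matI) (auto simp: lower_toeplitz_def)

section \<open>A generic lower triangular Toeplitz factor in order four\<close>

text \<open>The parameters of the generic factor \<open>V\<close> lie on a curve, so that genericity becomes a
  statement about the roots of polynomials in one variable. The exponents \<open>1, 3, 2\<close> make the
  maximal minors of the first \<open>k\<close> columns of \<open>V\<close> linearly independent polynomials in \<open>t\<close>, for
  \<open>k = 1, 2, 3\<close>. The geometric choice \<open>1, t, t\<^sup>2, t\<^sup>3\<close> would not do: there some of the minors
  for \<open>k = 2\<close> vanish identically.\<close>

definition weight :: "complex \<Rightarrow> complex fps" where
  "weight t = fps_of_poly [:1, t, t ^ 3, t ^ 2:]"

text \<open>The entries of the row vector \<open>r\<close> multiplied by \<open>V\<close>; see \<open>mult_lower_toeplitz_index\<close>.\<close>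

definition mix :: "complex \<Rightarrow> (nat \<Rightarrow> complex) \<Rightarrow> nat \<Rightarrow> complex" where
  "mix t r j = (\<Sum>l\<in>{j..<4}. r l * fps_nth (weight t) (l - j))"

lemma mult_lower_toeplitz_index:
  assumes "M \<in> carrier_mat 4 4" "i < 4" "j < 4"
  shows "(M * lower_toeplitz 4 (weight t)) $$ (i, j) = mix t (\<lambda>l. M $$ (i, l)) j"
proof -
  have "(M * lower_toeplitz 4 (weight t)) $$ (i, j) =
      (\<Sum>l<4. M $$ (i, l) * lower_toeplitz 4 (weight t) $$ (l, j))"
    by (rule mult_mat_index_sum) (use assms in auto)
  also have "\<dots> = mix t (\<lambda>l. M $$ (i, l)) j"
    unfolding mix_def
    by (rule sum.mono_neutral_cong_right) (use assms in \<open>auto simp: lower_toeplitz_def\<close>)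
  finally show ?thesis .
qed

lemma mix_values:
  "mix t r 0 = r 0 + t * r 1 + t ^ 3 * r 2 + t ^ 2 * r 3"
  "mix t r 1 = r 1 + t * r 2 + t ^ 3 * r 3"
  "mix t r 2 = r 2 + t * r 3"
  by (simp_all add: mix_def weight_def numeral_eq_Suc coeff_pCons algebra_simps)

lemma mix_linear:
  assumes "\<And>l. l < 4 \<Longrightarrow> r l = x * a l + y * b l"
  shows "mix t r j = x * mix t a j + y * mix t b j"
  unfolding mix_def using assms
  by (simp add: sum_distrib_left sum.distrib[symmetric] algebra_simps)

definition minor2 :: "(nat \<Rightarrow> complex) \<Rightarrow> (nat \<Rightarrow> complex) \<Rightarrow> nat \<Rightarrow> nat \<Rightarrow> complex" where
  "minor2 a b i j = a i * b j - a j * b i"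

definition minor3 ::
  "(nat \<Rightarrow> complex) \<Rightarrow> (nat \<Rightarrow> complex) \<Rightarrow> (nat \<Rightarrow> complex) \<Rightarrow> nat \<Rightarrow> nat \<Rightarrow> nat \<Rightarrow> complex" where
  "minor3 a b c i j k = minor2 a b i j * c k - minor2 a b i k * c j + minor2 a b j k * c i"

text \<open>This lemma and the next two say that linear independence of one, two or three rows
  survives in their leading minor after multiplication by \<open>V\<close>, for all but finitely many \<open>t\<close>.
  By the Cauchy-Binet formula the leading minor is a combination of the minors of the given
  rows, with the minors of \<open>V\<close> as coefficients. Collected by powers of \<open>t\<close>, it is the
  polynomial below, and linear independence of the minors of \<open>V\<close> means that this polynomial is
  zero only if all minors of the rows are zero.\<close>

lemma finite_zeros_mix:
  assumes "k < 4" "r k \<noteq> 0"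
  shows "finite {t. mix t r 0 = 0}"
proof -
  let ?p = "[:r 0, r 1, r 3, r 2:]"
  have "k = 0 \<or> k = 1 \<or> k = 2 \<or> k = 3" using assms(1) by auto
  then have "?p \<noteq> 0" using assms(2) by auto
  moreover have "mix t r 0 = poly ?p t" for t
    by (simp add: mix_values algebra_simps power2_eq_square power3_eq_cube)
  ultimately show ?thesis using poly_roots_finite[of ?p] by (simp only: not_False_eq_True)
qed

lemma finite_zeros_minor2_mix:
  assumes "i < 4" "j < 4" "minor2 a b i j \<noteq> 0"
  shows "finite {t. minor2 (mix t a) (mix t b) 0 1 = 0}"
proof -
  let ?D = "minor2 a b"
  let ?p = "[:?D 0 1, ?D 0 2, ?D 1 2 - ?D 1 3, ?D 0 3 - ?D 1 2 - ?D 2 3, ?D 1 3, 0, ?D 2 3:]"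
  have swap: "?D v u = 0" if "?D u v = 0" for u v
    using that by (simp add: minor2_def algebra_simps)
  have rep: "?D u u = 0" for u
    by (simp add: minor2_def)
  have "?p \<noteq> 0"
  proof
    assume "?p = 0"
    then have z: "?D 0 1 = 0" "?D 0 2 = 0" "?D 0 3 = 0" "?D 1 2 = 0" "?D 1 3 = 0" "?D 2 3 = 0"
      by auto
    have "i = 0 \<or> i = 1 \<or> i = 2 \<or> i = 3" "j = 0 \<or> j = 1 \<or> j = 2 \<or> j = 3"
      using assms(1,2) by auto
    then have "?D i j = 0"
      by (elim disjE; simp only: z z[THEN swap] rep)
    then show False using assms(3) by simp
  qed
  moreover have "minor2 (mix t a) (mix t b) 0 1 = poly ?p t" for t
    unfolding minor2_def mix_values
    by (simp add: algebra_simps power2_eq_square power3_eq_cube)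
  ultimately show ?thesis using poly_roots_finite[of ?p] by (simp only: not_False_eq_True)
qed

lemma finite_zeros_minor3_mix:
  assumes "i < 4" "j < 4" "k < 4" "minor3 a b c i j k \<noteq> 0"
  shows "finite {t. minor3 (mix t a) (mix t b) (mix t c) 0 1 2 = 0}"
proof -
  let ?D = "minor3 a b c"
  let ?p = "[:?D 0 1 2, ?D 0 1 3, ?D 0 2 3 + ?D 1 2 3, ?D 1 2 3 - ?D 0 2 3, - 2 * ?D 1 2 3:]"
  have swap: "?D u w v = 0" "?D v u w = 0" if "?D u v w = 0" for u v w
    using that by (simp_all add: minor3_def minor2_def algebra_simps)
  have perm: "?D u w v = 0" "?D v u w = 0" "?D v w u = 0" "?D w u v = 0" "?D w v u = 0"
    if "?D u v w = 0" for u v w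
    using swap that by blast+
  have rep: "?D u u w = 0" "?D u w u = 0" "?D w u u = 0" for u w
    by (simp_all add: minor3_def minor2_def algebra_simps)
  have "?p \<noteq> 0"
  proof
    assume "?p = 0"
    then have "?D 0 1 2 = 0" "?D 0 1 3 = 0" "?D 0 2 3 + ?D 1 2 3 = 0" "- 2 * ?D 1 2 3 = 0"
      unfolding pCons_eq_0_iff by blast+
    then have z: "?D 0 1 2 = 0" "?D 0 1 3 = 0" "?D 0 2 3 = 0" "?D 1 2 3 = 0"
      by simp_all
    have "i = 0 \<or> i = 1 \<or> i = 2 \<or> i = 3" "j = 0 \<or> j = 1 \<or> j = 2 \<or> j = 3"
        "k = 0 \<or> k = 1 \<or> k = 2 \<or> k = 3"
      using assms(1,2,3) by auto
    then have "?D i j k = 0"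
      by (elim disjE; simp only: z z[THEN perm(1)] z[THEN perm(2)] z[THEN perm(3)]
          z[THEN perm(4)] z[THEN perm(5)] rep)
    then show False using assms(4) by simp
  qed
  moreover have "minor3 (mix t a) (mix t b) (mix t c) 0 1 2 = poly ?p t" for t
    unfolding minor3_def minor2_def mix_values
    by (simp add: algebra_simps power2_eq_square power3_eq_cube)
  ultimately show ?thesis using poly_roots_finite[of ?p] by (simp only: not_False_eq_True)
qed


text \<open>Cramer's rule, with the weights as quotients of minors.\<close>

lemma cramer2:
  assumes "minor2 a b i j \<noteq> 0"
  shows "\<exists>x y. \<forall>r \<in> {a, b}. r m = x * r i + y * r j"
  using assms
  by (intro exI[of _ "minor2 a b m j / minor2 a b i j"] exI[of _ "minor2 a b i m / minor2 a b i j"])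
    (auto simp: field_simps, auto simp: minor2_def algebra_simps)

lemma cramer3:
  assumes "minor3 a b c i j k \<noteq> 0"
  shows "\<exists>x y z. \<forall>r \<in> {a, b, c}. r m = x * r i + y * r j + z * r k"
  using assms
  by (intro exI[of _ "minor3 a b c m j k / minor3 a b c i j k"]
      exI[of _ "minor3 a b c i m k / minor3 a b c i j k"]
      exI[of _ "minor3 a b c i j m / minor3 a b c i j k"])
    (auto simp: field_simps, auto simp: minor3_def minor2_def algebra_simps)

lemma multiple_if_minor2_zero:
  assumes "a i \<noteq> 0" "\<And>l. l < n \<Longrightarrow> minor2 a b i l = 0"
  shows "\<exists>x. \<forall>l<n. b l = x * a l"
  using assms by (intro exI[of _ "b i / a i"]) (auto simp: field_simps minor2_def)

text \<open>A vanishing \<open>3 \<times> 3\<close> minor is a linear equation for \<open>c l\<close> with the nonzero coefficient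
  \<open>minor2 a b i j\<close>; the weights of its solution do not involve \<open>l\<close>.\<close>

lemma combination_if_minor3_zero:
  assumes "minor2 a b i j \<noteq> 0" "\<And>l. l < n \<Longrightarrow> minor3 a b c i j l = 0"
  shows "\<exists>x y. \<forall>l<n. c l = x * a l + y * b l"
proof -
  have "minor2 a b i j * c l - (minor2 c b i j * a l + minor2 a c i j * b l) = minor3 a b c i j l"
    for l
    by (simp add: minor3_def minor2_def algebra_simps)
  then have "minor2 a b i j * c l = minor2 c b i j * a l + minor2 a c i j * b l" if "l < n" for l
    using assms(2)[OF that] by (metis eq_iff_diff_eq_0)
  then have "c l = minor2 c b i j / minor2 a b i j * a l + minor2 a c i j / minor2 a b i j * b l"
    if "l < n" for l
    using assms(1) that by (simp add: field_simps)
  then show ?thesis by blast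
qed

text \<open>Each of the finitely many conditions excludes only finitely many parameters, and \<open>\<complex>\<close> is
  infinite.\<close>

lemma generic_parameter_exists:
  fixes r :: "nat \<Rightarrow> nat \<Rightarrow> complex"
  obtains t where
    "\<And>p i. p < m \<Longrightarrow> i < 4 \<Longrightarrow> r p i \<noteq> 0 \<Longrightarrow> mix t (r p) 0 \<noteq> 0"
    "\<And>p q i j. p < m \<Longrightarrow> q < m \<Longrightarrow> i < 4 \<Longrightarrow> j < 4 \<Longrightarrow> minor2 (r p) (r q) i j \<noteq> 0 \<Longrightarrow>
       minor2 (mix t (r p)) (mix t (r q)) 0 1 \<noteq> 0"
    "\<And>p q u i j k. p < m \<Longrightarrow> q < m \<Longrightarrow> u < m \<Longrightarrow> i < 4 \<Longrightarrow> j < 4 \<Longrightarrow> k < 4 \<Longrightarrow>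
       minor3 (r p) (r q) (r u) i j k \<noteq> 0 \<Longrightarrow>
       minor3 (mix t (r p)) (mix t (r q)) (mix t (r u)) 0 1 2 \<noteq> 0"
proof -
  define bad1 where "bad1 p = {t. mix t (r p) 0 = 0}" for p
  define bad2 where "bad2 p q = {t. minor2 (mix t (r p)) (mix t (r q)) 0 1 = 0}" for p q
  define bad3 where
    "bad3 p q u = {t. minor3 (mix t (r p)) (mix t (r q)) (mix t (r u)) 0 1 2 = 0}" for p q u
  define F where "F = bad1 ` {..<m} \<union> (\<lambda>(p, q). bad2 p q) ` ({..<m} \<times> {..<m}) \<union>
    (\<lambda>(p, q, u). bad3 p q u) ` ({..<m} \<times> {..<m} \<times> {..<m})"
  \<comment> \<open>A zero set is infinite only if the minors of its rows all vanish; those are ignored.\<close>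
  have "finite F" by (simp add: F_def)
  then have "finite (\<Union>{S \<in> F. finite S})"
    by (intro finite_Union) simp_all
  then obtain t where "t \<notin> \<Union>{S \<in> F. finite S}"
    using ex_new_if_finite[OF infinite_UNIV_char_0] by blast
  then have avoid: "t \<notin> S" if "S \<in> F" "finite S" for S
    using that by blast
  show thesis
  proof
    show "mix t (r p) 0 \<noteq> 0" if "p < m" "i < 4" "r p i \<noteq> 0" for p i
    proof -
      have "bad1 p \<in> F" unfolding F_def using that by blast
      moreover have "finite (bad1 p)" unfolding bad1_def using that(2,3) by (rule finite_zeros_mix)
      ultimately have "t \<notin> bad1 p" by (rule avoid)
      then show ?thesis unfolding bad1_def by blast
    qed
    show "minor2 (mix t (r p)) (mix t (r q)) 0 1 \<noteq> 0"
      if "p < m" "q < m" "i < 4" "j < 4" "minor2 (r p) (r q) i j \<noteq> 0" for p q i j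
    proof -
      have "bad2 p q \<in> F" unfolding F_def using that(1,2) by force
      moreover have "finite (bad2 p q)" unfolding bad2_def using that(3-5)
        by (rule finite_zeros_minor2_mix)
      ultimately have "t \<notin> bad2 p q" by (rule avoid)
      then show ?thesis unfolding bad2_def by blast
    qed
    show "minor3 (mix t (r p)) (mix t (r q)) (mix t (r u)) 0 1 2 \<noteq> 0"
      if "p < m" "q < m" "u < m" "i < 4" "j < 4" "k < 4" "minor3 (r p) (r q) (r u) i j k \<noteq> 0"
      for p q u i j k
    proof -
      have "bad3 p q u \<in> F" unfolding F_def using that(1-3) by force
      moreover have "finite (bad3 p q u)" unfolding bad3_def using that(4-7)
        by (rule finite_zeros_minor3_mix)
      ultimately have "t \<notin> bad3 p q u" by (rule avoid)
      then show ?thesis unfolding bad3_def by blast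
    qed
  qed
qed

lemma minor3_eq_0_if_repeat:
  "minor3 a a c i j k = 0" "minor3 a b a i j k = 0" "minor3 a b b i j k = 0"
  by (auto simp: minor3_def minor2_def algebra_simps)

text \<open>The case distinction is on the rank \<open>\<rho>\<close> of the first \<open>k\<close> rows. Pick \<open>\<rho>\<close> independent ones
  among them. Their leading \<open>\<rho> \<times> \<rho>\<close> minor after multiplication by \<open>V\<close> is nonzero, so Cramer's
  rule solves the system for these rows with a \<open>w\<close> that is supported on the first \<open>\<rho>\<close> places.
  All other rows are combinations of the chosen ones and therefore satisfy the same equation.\<close>

lemma generic_leading_blocks_solvable:
  fixes r :: "nat \<Rightarrow> nat \<Rightarrow> complex"
  shows "\<exists>t. \<forall>k<4. \<exists>w. \<forall>p<k. (\<Sum>j<k. mix t (r p) j * w j) = mix t (r p) k"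
proof -
  obtain t where
    g1: "\<And>p i. p < 3 \<Longrightarrow> i < 4 \<Longrightarrow> r p i \<noteq> 0 \<Longrightarrow> mix t (r p) 0 \<noteq> 0" and
    g2: "\<And>p q i j. p < 3 \<Longrightarrow> q < 3 \<Longrightarrow> i < 4 \<Longrightarrow> j < 4 \<Longrightarrow> minor2 (r p) (r q) i j \<noteq> 0 \<Longrightarrow>
       minor2 (mix t (r p)) (mix t (r q)) 0 1 \<noteq> 0" and
    g3: "\<And>p q u i j k. p < 3 \<Longrightarrow> q < 3 \<Longrightarrow> u < 3 \<Longrightarrow> i < 4 \<Longrightarrow> j < 4 \<Longrightarrow> k < 4 \<Longrightarrow>
       minor3 (r p) (r q) (r u) i j k \<noteq> 0 \<Longrightarrow>
       minor3 (mix t (r p)) (mix t (r q)) (mix t (r u)) 0 1 2 \<noteq> 0"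
    by (rule generic_parameter_exists[of 3 r]) blast
  have "\<exists>w. \<forall>p<k. (\<Sum>j<k. mix t (r p) j * w j) = mix t (r p) k" if k: "k < 4" for k
  proof -
    let ?s = "\<lambda>p. mix t (r p)"
    consider (three) p q u i j l where "p < k" "q < k" "u < k" "i < 4" "j < 4" "l < 4"
        "minor3 (r p) (r q) (r u) i j l \<noteq> 0"
      | (two) p q i j where "p < k" "q < k" "i < 4" "j < 4" "minor2 (r p) (r q) i j \<noteq> 0"
        "\<And>u l. u < k \<Longrightarrow> l < 4 \<Longrightarrow> minor3 (r p) (r q) (r u) i j l = 0"
      | (one) p i where "p < k" "i < 4" "r p i \<noteq> 0"
        "\<And>q l. q < k \<Longrightarrow> l < 4 \<Longrightarrow> minor2 (r p) (r q) i l = 0"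
      | (zero) "\<And>p i. p < k \<Longrightarrow> i < 4 \<Longrightarrow> r p i = 0"
      by metis
    then show ?thesis
    proof cases
      case three
      have "p \<noteq> q" "p \<noteq> u" "q \<noteq> u"
        using three(7) minor3_eq_0_if_repeat by metis+
      \<comment> \<open>Three distinct rows below \<open>k < 4\<close> are all the rows there are.\<close>
      then have k3: "k = 3" and all: "\<And>v. v < 3 \<Longrightarrow> v \<in> {p, q, u}"
        using three(1-3) k by auto
      have "minor3 (?s p) (?s q) (?s u) 0 1 2 \<noteq> 0"
        using g3 three k3 by metis
      from cramer3[OF this, of 3] obtain x y z where
        "\<forall>s \<in> {?s p, ?s q, ?s u}. s 3 = x * s 0 + y * s 1 + z * s 2" by blast
      then have "?s v 3 = x * ?s v 0 + y * ?s v 1 + z * ?s v 2" if "v < 3" for v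
        using all[OF that] by auto
      then show ?thesis unfolding k3
        by (intro exI[of _ "\<lambda>j. if j = 0 then x else if j = 1 then y else z"])
          (simp add: numeral_eq_Suc algebra_simps)
    next
      case two
      have "p \<noteq> q" using two(5) by (auto simp: minor2_def)
      then have k2: "k \<ge> 2" using two(1,2) by auto
      have "minor2 (?s p) (?s q) 0 1 \<noteq> 0"
        using g2[of p q i j] two k by simp
      from cramer2[OF this, of k] obtain x y where
        xy: "?s p k = x * ?s p 0 + y * ?s p 1" "?s q k = x * ?s q 0 + y * ?s q 1" by auto
      have "?s u k = x * ?s u 0 + y * ?s u 1" if u: "u < k" for u
      proof -
        obtain \<alpha> \<beta> where "\<forall>l<4. r u l = \<alpha> * r p l + \<beta> * r q l"
          using combination_if_minor3_zero[OF two(5) two(6)[OF u]] by blast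
        then have "?s u l = \<alpha> * ?s p l + \<beta> * ?s q l" for l
          by (intro mix_linear) auto
        then show ?thesis using xy by (simp add: algebra_simps)
      qed
      moreover have "(\<Sum>j<k. ?s u j * (if j = 0 then x else if j = 1 then y else 0)) =
          x * ?s u 0 + y * ?s u 1" for u
      proof -
        have "(\<Sum>j<k. ?s u j * (if j = 0 then x else if j = 1 then y else 0)) =
            (\<Sum>j<2. ?s u j * (if j = 0 then x else if j = 1 then y else 0))"
          using k2 by (intro sum.mono_neutral_right) auto
        then show ?thesis by (simp add: numeral_2_eq_2)
      qed
      ultimately show ?thesis
        by (intro exI[of _ "\<lambda>j. if j = 0 then x else if j = 1 then y else 0"]) simp
    next
      case one
      have s0: "?s p 0 \<noteq> 0" using g1[of p i] one k by simp
      have "?s u k = ?s p k / ?s p 0 * ?s u 0" if u: "u < k" for u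
      proof -
        obtain \<alpha> where "\<forall>l<4. r u l = \<alpha> * r p l"
          using multiple_if_minor2_zero[OF one(3) one(4)[OF u]] by blast
        then have "?s u l = \<alpha> * ?s p l + 0 * ?s p l" for l
          by (intro mix_linear) auto
        then show ?thesis using s0 by (simp add: field_simps)
      qed
      moreover have "(\<Sum>j<k. ?s u j * (if j = 0 then x else 0)) = x * ?s u 0" for u x
      proof -
        have "(\<Sum>j<k. ?s u j * (if j = 0 then x else 0)) =
            (\<Sum>j<1. ?s u j * (if j = 0 then x else 0))"
          using one(1) by (intro sum.mono_neutral_right) auto
        then show ?thesis by simp
      qed
      ultimately show ?thesis
        by (intro exI[of _ "\<lambda>j. if j = 0 then ?s p k / ?s p 0 else 0"]) simp
    next
      case zero
      then have "?s p j = 0" if "p < k" for p j using that by (simp add: mix_def)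
      then show ?thesis by (intro exI[of _ "\<lambda>j. 0"]) simp
    qed
  qed
  then show ?thesis by blast
qed

lemma mat4_toeplitz_product_nine:
  assumes M: "M \<in> carrier_mat 4 4"
  shows "toeplitz_product 4 9 M"
proof -
  obtain t where t: "\<And>k. k < 4 \<Longrightarrow> \<exists>w. \<forall>p<k.
      (\<Sum>j<k. mix t (\<lambda>l. M $$ (p, l)) j * w j) = mix t (\<lambda>l. M $$ (p, l)) k"
    using generic_leading_blocks_solvable[of "\<lambda>p l. M $$ (p, l)"] by blast
  define V where "V = lower_toeplitz 4 (weight t)"
  define W where "W = lower_toeplitz 4 (inverse (weight t))"
  have "fps_nth (weight t) 0 \<noteq> 0" by (simp add: weight_def)
  then have VW: "V * W = 1\<^sub>m 4"
    by (simp add: V_def W_def lower_toeplitz_mult inverse_mult_eq_1' lower_toeplitz_one)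
  have "toeplitz_product 4 (2 * 4) (M * V)"
  proof (rule toeplitz_product_of_leading_blocks)
    show "M * V \<in> carrier_mat 4 4" using M by (simp add: V_def)
    show "\<exists>w. \<forall>i<k. (\<Sum>j<k. (M * V) $$ (i, j) * w j) = (M * V) $$ (i, k)" if "k < 4" for k
      using t[OF that] that M by (simp add: V_def mult_lower_toeplitz_index)
  qed
  then have "toeplitz_product 4 (2 * 4 + 1) (M * V * W)"
    by (intro toeplitz_product_mult toeplitz_product_one) (auto simp: W_def toeplitz_lower_toeplitz)
  moreover have "M * V * W = M * (V * W)"
    by (rule assoc_mult_mat[of _ 4 4 _ 4 _ 4]) (use M in \<open>auto simp: V_def W_def\<close>)
  ultimately show ?thesis using VW M by simp
qed

theorem theorem4p8:
  shows "3 \<le> toep_max 4 \<and> toep_max 4 \<le> 9"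
proof
  have "ramp_mat \<in> carrier_mat 4 4" by (simp add: ramp_mat_def)
  then have "toep 4 ramp_mat \<le> toep_max 4"
    unfolding toep_max_def by (intro Sup_upper) auto
  then show "3 \<le> toep_max 4" using toep_ramp_mat by (rule order_trans[rotated])
  have "toep 4 M \<le> 9" if "M \<in> carrier_mat 4 4" for M
    unfolding toep_eq
    by (rule Inf_lower) (use mat4_toeplitz_product_nine[OF that] in \<open>auto simp: numeral_eq_enat\<close>)
  then show "toep_max 4 \<le> 9"
    unfolding toep_max_def by (auto intro!: Sup_least)
qed

end
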